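(* Let $\lambda=(p_1-1,\ldots,p_t-1\,|\,q_1,\ldots,q_t)$ be a partition written in Frobenius notation, i.e. $t$ is the number of diagonal boxes of $\lambda$, $p_i=\lambda_i-i+1$ and $q_i=\lambda'_i-i$ for $1\le i\le t$. Let $\boldsymbol{\gamma}=(\gamma_{ij})\in T^{\mathrm{diag}}(\lambda,\mathbb{N})$ and write $c_k=\gamma_{i,i+k}$ for $k\in\mathbb{Z}$. Then $$S_\lambda(\boldsymbol{\gamma})=\det\left[S_{(p_i,1^{q_j})}(\boldsymbol{\gamma}_{i,j})\right]_{1\le i,j\le t},$$ where $\boldsymbol{\gamma}_{i,j}\in T((p_i,1^{q_j}),\mathbb{N})$ is the tableau of hook shape $(p_i,1^{q_j})$ whose first row is $c_0,c_1,\ldots,c_{p_i-1}$ and whose first column is $c_0,c_{-1},\ldots,c_{-q_j}$ (from top to bottom).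
   Context: $\mathbb{N}$ denotes the positive integers and $t_1,t_2,\ldots$ are commuting variables; identities hold among formal power series of bounded degree over $\mathbb{Z}$. $D(\lambda)=\{(i,j):1\le j\le\lambda_i\}$, $\lambda'_i=\#\{j:\lambda_j\ge i\}$. $T(\lambda,\mathbb{N})$ is the set of fillings of $D(\lambda)$ by positive integers; $T^{\mathrm{diag}}(\lambda,\mathbb{N})$ is the subset with $t_{ij}=t_{kl}$ whenever $j-i=l-k$; $\mathrm{SSYT}(\lambda)$ is the subset of semi-standard ones (rows weakly increasing, columns strictly increasing). $(p,1^q)$ is the partition with one part $p$ and $q$ parts $1$. The Schur type quasi-symmetric function is $S_\lambda(\boldsymbol{\gamma})=\sum_{(m_{ij})\in\mathrm{SSYT}(\lambda)}\prod_{(i,j)\in D(\lambda)}t_{m_{ij}}^{\gamma_{ij}}$. *)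

theory Defs
  imports
    "HOL-Library.Poly_Mapping"
    "HOL-Library.FuncSet"
    "Jordan_Normal_Form.Determinant"
begin

section \<open>Formal power series over the integers in the variables \<open>t\<^sub>n\<close>\<close>

text \<open>
  A monomial is a finitely supported exponent vector \<open>m :: nat \<Rightarrow>\<^sub>0 nat\<close>, and a power series is an
  arbitrary assignment of integer coefficients to monomials.  The series of bounded degree form a
  subring of this ring, so identities between such series may be stated here.
  The variables are \<open>t\<^sub>1, t\<^sub>2, \<dots>\<close>; the index type also provides a
  variable \<open>t\<^sub>0\<close>, which never occurs below because tableau entries are positive.
\<close>

typedef mfps = "UNIV :: ((nat \<Rightarrow>\<^sub>0 nat) \<Rightarrow> int) set"
  morphisms mcoeff Abs_mfps ..

setup_lifting type_definition_mfps

lemma mfps_eqI: "(\<And>m. mcoeff f m = mcoeff g m) \<Longrightarrow> f = g"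
  by (metis ext mcoeff_inject)

lemma finite_monom_below: "finite {a :: nat \<Rightarrow>\<^sub>0 nat. \<exists>b. a + b = m}"
proof -
  let ?N = "Max (insert 0 (Poly_Mapping.lookup m ` Poly_Mapping.keys m))"
  let ?F = "{f. \<forall>x. (x \<in> Poly_Mapping.keys m \<longrightarrow> f x \<in> {..?N}) \<and>
    (x \<notin> Poly_Mapping.keys m \<longrightarrow> f x = 0)}"
  have "finite ?F"
    by (rule finite_set_of_finite_funs) auto
  moreover have "Poly_Mapping.lookup ` {a. \<exists>b. a + b = m} \<subseteq> ?F"
  proof safe
    fix a b x
    assume m: "m = a + b"
    have le: "Poly_Mapping.lookup a x \<le> Poly_Mapping.lookup (a + b) x"
      by (simp add: lookup_add)
    {
      assume "x \<in> Poly_Mapping.keys (a + b)"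
      then have "Poly_Mapping.lookup (a + b) x
          \<le> Max (insert 0 (Poly_Mapping.lookup (a + b) ` Poly_Mapping.keys (a + b)))"
        by (intro Max_ge) auto
      with le show "Poly_Mapping.lookup a x
          \<le> Max (insert 0 (Poly_Mapping.lookup (a + b) ` Poly_Mapping.keys (a + b)))" by linarith
    next
      assume "x \<notin> Poly_Mapping.keys (a + b)"
      with le show "Poly_Mapping.lookup a x = 0" by (simp add: in_keys_iff)
    }
  qed
  ultimately have "finite (Poly_Mapping.lookup ` {a. \<exists>b. a + b = m})"
    by (rule finite_subset[rotated])
  moreover have "inj_on Poly_Mapping.lookup {a. \<exists>b. a + b = m}"
    by (auto intro!: inj_onI poly_mapping_eqI)
  ultimately show ?thesis by (rule finite_imageD)
qed

lemma finite_monom_splits: "finite {(a, b). a + b = (m :: nat \<Rightarrow>\<^sub>0 nat)}"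
proof -
  have "{(a, b). a + b = m} \<subseteq> {a. \<exists>b. a + b = m} \<times> {b. \<exists>a. b + a = m}"
  proof clarify
    fix a b :: "nat \<Rightarrow>\<^sub>0 nat"
    show "a \<in> {a'. \<exists>b'. a' + b' = a + b} \<and> b \<in> {b'. \<exists>a'. b' + a' = a + b}"
      using add.commute[of b a] by blast
  qed
  then show ?thesis
    by (rule finite_subset) (simp add: finite_monom_below)
qed

instantiation mfps :: comm_ring_1
begin

lift_definition zero_mfps :: mfps is "\<lambda>_. 0" .
lift_definition one_mfps :: mfps is "\<lambda>m. if m = 0 then 1 else 0" .
lift_definition plus_mfps :: "mfps \<Rightarrow> mfps \<Rightarrow> mfps" is "\<lambda>f g m. f m + g m" .
lift_definition minus_mfps :: "mfps \<Rightarrow> mfps \<Rightarrow> mfps" is "\<lambda>f g m. f m - g m" .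
lift_definition uminus_mfps :: "mfps \<Rightarrow> mfps" is "\<lambda>f m. - f m" .
lift_definition times_mfps :: "mfps \<Rightarrow> mfps \<Rightarrow> mfps"
  is "\<lambda>f g m. \<Sum>(a, b) | a + b = m. f a * g b" .

instance
proof
  fix f g h :: mfps
  show "f + g + h = f + (g + h)" by transfer (simp add: add.assoc)
  show "f + g = g + f" by transfer (simp add: add.commute)
  show "0 + f = f" by transfer simp
  show "- f + f = 0" by transfer simp
  show "f - g = f + - g" by transfer simp
  show "(0 :: mfps) \<noteq> 1" by transfer (metis zero_neq_one)
  show "f * g = g * f"
  proof (rule mfps_eqI)
    fix m
    show "mcoeff (f * g) m = mcoeff (g * f) m"
      unfolding times_mfps.rep_eq
      by (rule sum.reindex_bij_witness[of _ prod.swap prod.swap])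
         (auto simp: add.commute mult.commute)
  qed
  show "(f + g) * h = f * h + g * h"
    by (rule mfps_eqI)
       (simp add: times_mfps.rep_eq plus_mfps.rep_eq distrib_right sum.distrib case_prod_unfold)
  show "1 * f = f"
  proof (rule mfps_eqI)
    fix m
    have "mcoeff (1 * f) m = (\<Sum>(a, b)\<in>{(0, m)}. mcoeff 1 a * mcoeff f b)"
      unfolding times_mfps.rep_eq
      by (rule sum.mono_neutral_right)
         (auto simp: finite_monom_splits one_mfps.rep_eq split: if_splits)
    then show "mcoeff (1 * f) m = mcoeff f m" by (simp add: one_mfps.rep_eq)
  qed
  show "f * g * h = f * (g * h)"
  proof (rule mfps_eqI)
    fix m
    let ?S = "\<lambda>m :: nat \<Rightarrow>\<^sub>0 nat. {(a, b). a + b = m}"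
    have "mcoeff (f * g * h) m =
        (\<Sum>p\<in>?S m. \<Sum>q\<in>?S (fst p). mcoeff f (fst q) * mcoeff g (snd q) * mcoeff h (snd p))"
      by (simp add: times_mfps.rep_eq sum_distrib_right case_prod_unfold)
    also have "\<dots> = (\<Sum>(p, q)\<in>Sigma (?S m) (\<lambda>p. ?S (fst p)).
        mcoeff f (fst q) * mcoeff g (snd q) * mcoeff h (snd p))"
      by (rule sum.Sigma) (auto simp: finite_monom_splits)
    also have "\<dots> = (\<Sum>(p, q)\<in>Sigma (?S m) (\<lambda>p. ?S (snd p)).
        mcoeff f (fst p) * (mcoeff g (fst q) * mcoeff h (snd q)))"
      by (rule sum.reindex_bij_witness
            [of _ "\<lambda>(p, q). ((fst p + fst q, snd q), (fst p, fst q))"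
                  "\<lambda>(p, q). ((fst q, snd q + snd p), (snd q, snd p))"])
         (auto simp: add.assoc mult.assoc)
    also have "\<dots> = (\<Sum>p\<in>?S m. \<Sum>q\<in>?S (snd p).
        mcoeff f (fst p) * (mcoeff g (fst q) * mcoeff h (snd q)))"
      by (rule sum.Sigma[symmetric]) (auto simp: finite_monom_splits)
    also have "\<dots> = mcoeff (f * (g * h)) m"
      by (simp add: times_mfps.rep_eq sum_distrib_left case_prod_unfold)
    finally show "mcoeff (f * g * h) m = mcoeff (f * (g * h)) m" .
  qed
qed

end

lift_definition tvar :: "nat \<Rightarrow> mfps"
  is "\<lambda>n m. if m = Poly_Mapping.single n 1 then 1 else 0" .

text \<open>
  Formal sum of a possibly infinite family.  It is meaningful when every monomial has a nonzero
  coefficient in only finitely many members of the family; for the families used below this is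
  the lemma \<open>SSYT_summable\<close>.
\<close>

lift_definition formal_sum :: "('a \<Rightarrow> mfps) \<Rightarrow> 'a set \<Rightarrow> mfps"
  is "\<lambda>F A m. \<Sum>x | x \<in> A \<and> F x m \<noteq> 0. F x m" .


section \<open>Partitions and tableaux\<close>

text \<open>A partition is the list of its nonzero parts; rows and columns are numbered from 1.\<close>

definition is_partition :: "nat list \<Rightarrow> bool" where
  "is_partition lam \<longleftrightarrow> sorted_wrt (\<ge>) lam \<and> 0 \<notin> set lam"

definition part :: "nat list \<Rightarrow> nat \<Rightarrow> nat" where
  "part lam i = (if 1 \<le> i \<and> i \<le> length lam then lam ! (i - 1) else 0)"

definition conj_part :: "nat list \<Rightarrow> nat \<Rightarrow> nat" where
  "conj_part lam i = card {j. 1 \<le> j \<and> part lam j \<ge> i}"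

definition diagram :: "nat list \<Rightarrow> (nat \<times> nat) set" where
  "diagram lam = {(i, j). 1 \<le> i \<and> 1 \<le> j \<and> j \<le> part lam i}"

text \<open>
  A filling is an extensional function (value \<open>undefined\<close> off the diagram), so that
  distinct functions are distinct fillings and sums over tableaux count each one once.
\<close>

definition fillings :: "nat list \<Rightarrow> (nat \<times> nat \<Rightarrow> nat) set" where
  "fillings lam = diagram lam \<rightarrow>\<^sub>E {1..}"

definition diag_fillings :: "nat list \<Rightarrow> (nat \<times> nat \<Rightarrow> nat) set" where
  "diag_fillings lam = {T \<in> fillings lam.
     \<forall>(i, j) \<in> diagram lam. \<forall>(k, l) \<in> diagram lam.
       int j - int i = int l - int k \<longrightarrow> T (i, j) = T (k, l)}"

definition SSYT :: "nat list \<Rightarrow> (nat \<times> nat \<Rightarrow> nat) set" where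
  "SSYT lam = {T \<in> fillings lam.
     (\<forall>i j l. (i, j) \<in> diagram lam \<and> (i, l) \<in> diagram lam \<and> j < l \<longrightarrow> T (i, j) \<le> T (i, l)) \<and>
     (\<forall>i k j. (i, j) \<in> diagram lam \<and> (k, j) \<in> diagram lam \<and> i < k \<longrightarrow> T (i, j) < T (k, j))}"

definition schur_qsym :: "nat list \<Rightarrow> (nat \<times> nat \<Rightarrow> nat) \<Rightarrow> mfps" where
  "schur_qsym lam \<gamma> = formal_sum (\<lambda>T. \<Prod>b\<in>diagram lam. tvar (T b) ^ \<gamma> b) (SSYT lam)"

definition hook :: "nat \<Rightarrow> nat \<Rightarrow> nat list" where
  "hook p q = p # replicate q 1"

text \<open>First row \<open>c 0, c 1, \<dots>, c (p - 1)\<close>; first column \<open>c 0, c (-1), \<dots>, c (-q)\<close>.\<close>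

definition hook_filling :: "(int \<Rightarrow> nat) \<Rightarrow> nat \<Rightarrow> nat \<Rightarrow> nat \<times> nat \<Rightarrow> nat" where
  "hook_filling c p q = restrict
     (\<lambda>(i, j). if i = 1 then c (int j - 1) else c (- (int i - 1))) (diagram (hook p q))"


subsection \<open>The sums defining \<open>schur_qsym\<close> are well defined\<close>

lemma finite_diagram: "finite (diagram lam)"
proof (rule finite_subset)
  show "diagram lam \<subseteq> {..length lam} \<times> {..sum_list lam}"
  proof clarify
    fix i j
    assume "(i, j) \<in> diagram lam"
    then have i: "1 \<le> i" "i \<le> length lam" and "j \<le> lam ! (i - 1)"
      by (auto simp: diagram_def part_def split: if_splits)
    moreover have "lam ! (i - 1) \<le> sum_list lam"
      using i by (intro member_le_sum_list nth_mem) auto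
    ultimately show "i \<in> {..length lam} \<and> j \<in> {..sum_list lam}" by simp
  qed
qed simp

definition mmonom :: "(nat \<Rightarrow>\<^sub>0 nat) \<Rightarrow> mfps" where
  "mmonom m = Abs_mfps (\<lambda>k. if k = m then 1 else 0)"

lemma mcoeff_mmonom: "mcoeff (mmonom m) k = (if k = m then 1 else 0)"
  by (simp add: mmonom_def Abs_mfps_inverse)

lemma tvar_conv_mmonom: "tvar n = mmonom (Poly_Mapping.single n 1)"
  by (rule mfps_eqI) (simp add: mcoeff_mmonom tvar.rep_eq)

lemma mmonom_0: "mmonom 0 = 1"
  by (rule mfps_eqI) (simp add: mcoeff_mmonom one_mfps.rep_eq)

lemma mmonom_mult: "mmonom a * mmonom b = mmonom (a + b)"
proof (rule mfps_eqI)
  fix m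
  have "mcoeff (mmonom a * mmonom b) m =
      (\<Sum>p\<in>{(x, y). x + y = m}. if p = (a, b) then 1 else 0)"
    unfolding times_mfps.rep_eq
    by (rule sum.cong) (simp_all add: mcoeff_mmonom case_prod_unfold prod_eq_iff)
  also have "\<dots> = mcoeff (mmonom (a + b)) m"
    by (subst sum.delta[OF finite_monom_splits]) (auto simp: mcoeff_mmonom)
  finally show "mcoeff (mmonom a * mmonom b) m = mcoeff (mmonom (a + b)) m" .
qed

lemma tvar_power: "tvar n ^ k = mmonom (Poly_Mapping.single n k)"
  by (induction k) (simp_all add: mmonom_0 mmonom_mult tvar_conv_mmonom single_add[symmetric])

lemma prod_mmonom: "(\<Prod>b\<in>B. mmonom (f b)) = mmonom (\<Sum>b\<in>B. f b)"
  by (induction B rule: infinite_finite_induct) (simp_all add: mmonom_0 mmonom_mult)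

lemma SSYT_summable:
  assumes "\<gamma> \<in> fillings lam"
  shows "finite {T \<in> SSYT lam. mcoeff (\<Prod>b\<in>diagram lam. tvar (T b) ^ \<gamma> b) m \<noteq> 0}"
proof (rule finite_subset)
  show "{T \<in> SSYT lam. mcoeff (\<Prod>b\<in>diagram lam. tvar (T b) ^ \<gamma> b) m \<noteq> 0}
      \<subseteq> diagram lam \<rightarrow>\<^sub>E Poly_Mapping.keys m"
  proof
    fix T
    assume T: "T \<in> {T \<in> SSYT lam. mcoeff (\<Prod>b\<in>diagram lam. tvar (T b) ^ \<gamma> b) m \<noteq> 0}"
    then have m: "m = (\<Sum>b\<in>diagram lam. Poly_Mapping.single (T b) (\<gamma> b))"
      by (simp add: tvar_power prod_mmonom mcoeff_mmonom split: if_splits)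
    have "T b \<in> Poly_Mapping.keys m" if b: "b \<in> diagram lam" for b
    proof -
      have "0 < \<gamma> b" using assms b by (auto simp: fillings_def dest: PiE_mem)
      also have "\<gamma> b \<le> (\<Sum>x\<in>diagram lam.
          Poly_Mapping.lookup (Poly_Mapping.single (T x) (\<gamma> x)) (T b))"
        using b finite_diagram member_le_sum
          [of b "diagram lam" "\<lambda>x. Poly_Mapping.lookup (Poly_Mapping.single (T x) (\<gamma> x)) (T b)"]
        by simp
      also have "\<dots> = Poly_Mapping.lookup m (T b)" by (simp add: m lookup_sum)
      finally show ?thesis by (simp add: in_keys_iff)
    qed
    moreover have "T \<in> extensional (diagram lam)"
      using T by (auto simp: SSYT_def fillings_def PiE_def)
    ultimately show "T \<in> diagram lam \<rightarrow>\<^sub>E Poly_Mapping.keys m"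
      by (simp add: PiE_iff)
  qed
  show "finite (diagram lam \<rightarrow>\<^sub>E Poly_Mapping.keys m)"
    by (simp add: finite_PiE finite_diagram)
qed

end

theory Submission
  imports Defs
begin

text \<open>
  Giambelli's formula for Schur functions survives when the variable \<open>t\<^sub>m\<close> in a box is replaced by
  a weight \<open>x k m\<close> that also depends on the content \<open>k\<close> of the box.  The Schur type
  quasi-symmetric function of a tableau that is constant along diagonals is the case
  \<open>x k m = t\<^sub>m ^ c k\<close>.

  The weighted tableaux are built one box at a time.  Order the pairs (entry, content)
  lexicographically.  In a semistandard tableau the box with the largest pair \<open>(n, k)\<close> is a corner of
  the shape, and any tableau on the shape without a corner of content \<open>k\<close>, with all pairs below
  \<open>(n, k)\<close>, can be completed by putting \<open>n\<close> into that corner.  So admitting one more pair changes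
  the generating function, as a function of the shape, by the operator
  \<open>f D \<mapsto> f D + x k n * f (D - corner of content k)\<close>, where the last term is absent if there is no such
  corner (\<open>tableau_sum_corner_step\<close>).  When no pair is admitted, the function is 1 on the empty
  shape and 0 elsewhere.

  The key point is that this operator preserves the determinantal identity
  \<open>f (a | b) = det (f (a\<^sub>i | b\<^sub>j))\<close> in Frobenius coordinates, whatever the function \<open>f\<close> is
  (\<open>giambelli_corner_step\<close>).  A corner of content \<open>k > 0\<close> is removed by lowering some
  \<open>a\<^sub>i = k\<close> by one, and the operator acts on the matrix by adding to row \<open>i\<close> a multiple of the row
  with arm \<open>k - 1\<close>.  If the latter already occurs as the next row, the determinant does not change,
  and indeed there is no corner; otherwise the change is the determinant of the smaller shape.
  Negative contents are the transposed case.  For content 0 only the last diagonal entry changes,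
  by a multiple of \<open>f {} = 1\<close>, which contributes the minor belonging to the shape without its last
  diagonal box.

  All this takes place with entries bounded by some \<open>N\<close>, hence with finite sums.  Setting
  \<open>t\<^sub>n = 0\<close> for \<open>n > N\<close> is a ring homomorphism, so it commutes with determinants, and a power
  series is determined by all its truncations of this kind.
\<close>

section \<open>Two determinant expansions\<close>

lemma det_row_linear:
  fixes u v :: "nat \<Rightarrow> 'a :: comm_ring_1"
  assumes k: "k < n"
  shows "det (mat n n (\<lambda>(i, j). if i = k then u j + y * v j else f i j)) =
    det (mat n n (\<lambda>(i, j). if i = k then u j else f i j)) +
    y * det (mat n n (\<lambda>(i, j). if i = k then v j else f i j))"
proof -
  let ?M = "\<lambda>w. mat n n (\<lambda>(i, j). if i = k then w j else f i j)"
  have cof: "cofactor (?M w) k j = cofactor (?M w') k j" if "j < n" for w w' j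
  proof -
    have "mat_delete (?M w) k j = mat_delete (?M w') k j"
      by (rule eq_matI) (auto simp: mat_delete_def)
    then show ?thesis by (simp add: cofactor_def)
  qed
  have exp: "det (?M w) = (\<Sum>j<n. w j * cofactor (?M v) k j)" for w
  proof -
    have "det (?M w) = (\<Sum>j<n. ?M w $$ (k, j) * cofactor (?M w) k j)"
      by (rule laplace_expansion_row[OF _ k]) simp
    also have "\<dots> = (\<Sum>j<n. w j * cofactor (?M v) k j)"
      by (rule sum.cong[OF refl]) (use k cof[of _ w v] in simp)
    finally show ?thesis .
  qed
  show ?thesis
    unfolding exp[of "\<lambda>j. u j + y * v j"] exp[of u] exp[of v]
    by (simp add: sum.distrib sum_distrib_left distrib_right mult.assoc)
qed

lemma det_add_last_diagonal:
  fixes f :: "nat \<Rightarrow> nat \<Rightarrow> 'a :: comm_ring_1"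
  shows "det (mat (Suc n) (Suc n) (\<lambda>(i, j). f i j + (if i = n \<and> j = n then y else 0))) =
    det (mat (Suc n) (Suc n) (\<lambda>(i, j). f i j)) + y * det (mat n n (\<lambda>(i, j). f i j))"
proof -
  let ?e = "\<lambda>j. if j = n then 1 else (0 :: 'a)"
  let ?E = "mat (Suc n) (Suc n) (\<lambda>(i, j). if i = n then ?e j else f i j)"
  have "det ?E = (\<Sum>j<Suc n. ?E $$ (n, j) * cofactor ?E n j)"
    by (rule laplace_expansion_row) simp_all
  also have "\<dots> = cofactor ?E n n" by simp
  also have "mat_delete ?E n n = mat n n (\<lambda>(i, j). f i j)"
    by (rule eq_matI) (auto simp: mat_delete_def)
  then have "cofactor ?E n n = det (mat n n (\<lambda>(i, j). f i j))"
    by (simp add: cofactor_def flip: mult_2)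
  finally have E: "det ?E = det (mat n n (\<lambda>(i, j). f i j))" .
  have "mat (Suc n) (Suc n) (\<lambda>(i, j). f i j + (if i = n \<and> j = n then y else 0)) =
      mat (Suc n) (Suc n) (\<lambda>(i, j). if i = n then f n j + y * ?e j else f i j)"
    by (rule cong_mat) auto
  moreover have "mat (Suc n) (Suc n) (\<lambda>(i, j). f i j) =
      mat (Suc n) (Suc n) (\<lambda>(i, j). if i = n then f n j else f i j)"
    by (rule cong_mat) auto
  ultimately show ?thesis
    using E by (simp add: det_row_linear)
qed

section \<open>Shapes in Frobenius coordinates\<close>

text \<open>
  The shape \<open>(a 0, \<dots>, a (t - 1) | b 0, \<dots>, b (t - 1))\<close>, as the union of its hooks along the main
  diagonal.  The Frobenius coordinates count from 0, like the indices of matrices, whereas boxes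
  count from 1.
\<close>

definition frobenius_shape :: "nat \<Rightarrow> (nat \<Rightarrow> nat) \<Rightarrow> (nat \<Rightarrow> nat) \<Rightarrow> (nat \<times> nat) set" where
  "frobenius_shape t a b =
     {(Suc i, Suc (i + m)) | i m. i < t \<and> m \<le> a i} \<union> {(Suc (i + m), Suc i) | i m. i < t \<and> m \<le> b i}"

abbreviation hook_shape :: "nat \<Rightarrow> nat \<Rightarrow> (nat \<times> nat) set" where
  "hook_shape u v \<equiv> frobenius_shape (Suc 0) (\<lambda>_. u) (\<lambda>_. v)"

definition box_content :: "nat \<times> nat \<Rightarrow> int" where
  "box_content z = int (snd z) - int (fst z)"

text \<open>
  The last two conditions make sense for arbitrary sets of boxes; for the diagram of a partition they
  say that removing the box leaves the diagram of a partition.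
\<close>

definition corners :: "int \<Rightarrow> (nat \<times> nat) set \<Rightarrow> (nat \<times> nat) set" where
  "corners k D = {(i, j) \<in> D. box_content (i, j) = k \<and>
     (\<forall>l > j. (i, l) \<notin> D) \<and> (\<forall>l > i. (l, j) \<notin> D)}"

lemma mem_frobenius_shape:
  "(r, c) \<in> frobenius_shape t a b \<longleftrightarrow>
     (1 \<le> r \<and> r \<le> c \<and> r \<le> t \<and> c \<le> r + a (r - 1)) \<or> (1 \<le> c \<and> c \<le> r \<and> c \<le> t \<and> r \<le> c + b (c - 1))"
proof -
  have "(r, c) \<in> {(Suc i, Suc (i + m)) | i m. i < t \<and> m \<le> a i} \<longleftrightarrow>
      1 \<le> r \<and> r \<le> c \<and> r \<le> t \<and> c \<le> r + a (r - 1)" for r c t and a :: "nat \<Rightarrow> nat"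
    by (cases r; cases c) (auto intro: exI[of _ "c - r"])
  from this[of r c t a] this[of c r t b] show ?thesis
    unfolding frobenius_shape_def by auto
qed

lemma finite_frobenius_shape: "finite (frobenius_shape t a b)"
proof -
  have "frobenius_shape t a b =
      (\<Union>i<t. \<Union>m\<le>a i. {(Suc i, Suc (i + m))}) \<union> (\<Union>i<t. \<Union>m\<le>b i. {(Suc (i + m), Suc i)})"
    unfolding frobenius_shape_def by blast
  then show ?thesis by simp
qed

lemma frobenius_shape_cong:
  assumes "\<And>i. i < t \<Longrightarrow> a i = a' i" "\<And>i. i < t \<Longrightarrow> b i = b' i"
  shows "frobenius_shape t a b = frobenius_shape t a' b'"
  using assms unfolding frobenius_shape_def by auto

lemma frobenius_shape_swap: "prod.swap ` frobenius_shape t a b = frobenius_shape t b a"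
proof -
  have "(r, c) \<in> prod.swap ` frobenius_shape t a b \<longleftrightarrow> (r, c) \<in> frobenius_shape t b a" for r c
    unfolding pair_in_swap_image mem_frobenius_shape by auto
  then show ?thesis by (simp only: set_eq_iff split_paired_All) simp
qed

text \<open>
  The ends of the arms, measured by column, weakly move to the left from one row to the next.
\<close>

lemma strict_antimono_on_gap:
  fixes a :: "nat \<Rightarrow> nat"
  assumes "strict_antimono_on {..<t} a" "i \<le> j" "j < t"
  shows "a j + j \<le> a i + i"
  using assms(2,3)
proof (induction j rule: dec_induct)
  case (step j)
  have "a (Suc j) < a j"
    using assms(1) step by (auto simp: monotone_on_def)
  with step show ?case by simp
qed simp

text \<open>
  A box of positive content \<open>k\<close> lies on the arm of a diagonal box; it can only be removed if it ends
  this arm, so that \<open>a i = k\<close>, and if the next arm ends strictly further to the left.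
\<close>

lemma corners_frobenius_shape_pos:
  assumes a: "strict_antimono_on {..<t} a" and k: "0 < k"
  shows "corners (int k) (frobenius_shape t a b) =
    {(Suc i, Suc (i + k)) | i. i < t \<and> a i = k \<and> (Suc i < t \<longrightarrow> a (Suc i) \<noteq> k - 1)}"
    (is "_ = ?R")
proof (intro subset_antisym subsetI)
  fix z
  assume "z \<in> corners (int k) (frobenius_shape t a b)"
  moreover obtain r c where "z = (r, c)" by (cases z)
  ultimately have corner: "(r, c) \<in> corners (int k) (frobenius_shape t a b)" by simp
  then have "c = r + k" by (simp add: corners_def box_content_def)
  with \<open>z = (r, c)\<close> have z: "z = (r, r + k)" by simp
  from corner have mem: "(r, r + k) \<in> frobenius_shape t a b"
    and right: "(r, Suc (r + k)) \<notin> frobenius_shape t a b"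
    and below: "(Suc r, r + k) \<notin> frobenius_shape t a b"
    unfolding corners_def \<open>c = r + k\<close> by blast+
  from mem k obtain i where r: "r = Suc i" and i: "i < t" "k \<le> a i"
    by (cases r) (auto simp: mem_frobenius_shape)
  from right i have "a i = k" by (auto simp: r mem_frobenius_shape)
  moreover from below have "Suc i < t \<longrightarrow> a (Suc i) \<noteq> k - 1"
    using k by (auto simp: r mem_frobenius_shape)
  ultimately show "z \<in> ?R" using i by (auto simp: z r)
next
  fix z
  assume "z \<in> ?R"
  then obtain i where z: "z = (Suc i, Suc (i + k))" and i: "i < t" "a i = k"
    and next_row: "Suc i < t \<Longrightarrow> a (Suc i) \<noteq> k - 1" by auto
  \<comment> \<open>The arms of all lower rows, also of those that start to the right of the box, end before its column.\<close>
  have short: "a j + j < i + k" if "i < j" "j < t" for j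
  proof -
    have "a (Suc i) < k" using a i that by (auto simp: monotone_on_def)
    with next_row that have "a (Suc i) < k - 1" by force
    moreover have "a j + j \<le> a (Suc i) + Suc i"
      using that by (intro strict_antimono_on_gap[OF a]) auto
    ultimately show ?thesis by simp
  qed
  have "(l, Suc (i + k)) \<notin> frobenius_shape t a b" if "Suc i < l" for l
    using short[of "l - 1"] short[of "i + k"] k that by (cases l) (auto simp: mem_frobenius_shape)
  moreover have "(Suc i, l) \<notin> frobenius_shape t a b" if "Suc (i + k) < l" for l
    using i that by (auto simp: mem_frobenius_shape)
  ultimately show "z \<in> corners (int k) (frobenius_shape t a b)"
    using i by (auto simp: z corners_def box_content_def mem_frobenius_shape)
qed

lemma frobenius_shape_remove_pos:
  assumes "i < t" "a i = k" "0 < k"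
  shows "frobenius_shape t a b - {(Suc i, Suc (i + k))} = frobenius_shape t (a(i := k - 1)) b"
  using assms by (auto simp: mem_frobenius_shape fun_upd_def split: if_splits)

text \<open>
  A diagonal box other than the last one has a nonempty arm, because \<open>a\<close> decreases strictly.
\<close>

lemma corners_zero_Suc:
  assumes a: "strict_antimono_on {..<Suc s} a" and b: "strict_antimono_on {..<Suc s} b"
  shows "corners 0 (frobenius_shape (Suc s) a b) =
    (if a s = 0 \<and> b s = 0 then {(Suc s, Suc s)} else {})"
proof (intro subset_antisym subsetI)
  fix z
  assume "z \<in> corners 0 (frobenius_shape (Suc s) a b)"
  moreover obtain r c where "z = (r, c)" by (cases z)
  ultimately have corner: "(r, c) \<in> corners 0 (frobenius_shape (Suc s) a b)" by simp
  then have "c = r" by (simp add: corners_def box_content_def)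
  with \<open>z = (r, c)\<close> have z: "z = (r, r)" by simp
  from corner have mem: "(r, r) \<in> frobenius_shape (Suc s) a b"
    and right: "(r, Suc r) \<notin> frobenius_shape (Suc s) a b"
    and below: "(Suc r, r) \<notin> frobenius_shape (Suc s) a b"
    unfolding corners_def \<open>c = r\<close> by blast+
  from mem have r: "1 \<le> r" "r \<le> Suc s" by (auto simp: mem_frobenius_shape)
  from right below r have 0: "a (r - 1) = 0" "b (r - 1) = 0"
    by (auto simp: mem_frobenius_shape)
  have "r = Suc s"
  proof (rule ccontr)
    assume "r \<noteq> Suc s"
    with a r have "a r < a (r - 1)" by (auto simp: monotone_on_def)
    with 0 show False by simp
  qed
  with 0 z show "z \<in> (if a s = 0 \<and> b s = 0 then {(Suc s, Suc s)} else {})" by simp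
next
  fix z
  assume "z \<in> (if a s = 0 \<and> b s = 0 then {(Suc s, Suc s)} else {})"
  then show "z \<in> corners 0 (frobenius_shape (Suc s) a b)"
    by (auto simp: corners_def box_content_def mem_frobenius_shape split: if_splits)
qed

lemma frobenius_shape_remove_zero:
  assumes "a s = 0" "b s = 0"
  shows "frobenius_shape (Suc s) a b - {(Suc s, Suc s)} = frobenius_shape s a b"
proof -
  have "frobenius_shape (Suc s) a b = insert (Suc s, Suc s) (frobenius_shape s a b)"
    using assms by (auto simp: mem_frobenius_shape le_Suc_eq)
  moreover have "(Suc s, Suc s) \<notin> frobenius_shape s a b" by (simp add: mem_frobenius_shape)
  ultimately show ?thesis by auto
qed

lemma frobenius_shape_0 [simp]: "frobenius_shape 0 a b = {}"
  by (simp add: frobenius_shape_def)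

section \<open>Determinantal functions of shapes\<close>

text \<open>
  The bound \<open>K\<close> confines the contents of the shapes to \<open>{- K..K}\<close>, so that only finitely many
  contents have to be admitted for each entry.
\<close>

definition giambelli :: "nat \<Rightarrow> ((nat \<times> nat) set \<Rightarrow> 'a :: comm_ring_1) \<Rightarrow> bool" where
  "giambelli K f \<longleftrightarrow> (\<forall>t a b. strict_antimono_on {..<t} a \<longrightarrow> strict_antimono_on {..<t} b \<longrightarrow>
     (\<forall>i<t. a i \<le> K \<and> b i \<le> K) \<longrightarrow>
     f (frobenius_shape t a b) = det (mat t t (\<lambda>(i, j). f (hook_shape (a i) (b j)))))"

text \<open>
  For the diagram of a partition the sum has at most one term, see \<open>corners_frobenius_shape_unique\<close>.
\<close>

definition corner_step :: "'a \<Rightarrow> int \<Rightarrow> ((nat \<times> nat) set \<Rightarrow> 'a) \<Rightarrow> (nat \<times> nat) set \<Rightarrow> 'a :: comm_ring_1"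
  where "corner_step y k f D = f D + (\<Sum>z\<in>corners k D. y * f (D - {z}))"

lemma giambelliI:
  assumes "\<And>t a b. strict_antimono_on {..<t} a \<Longrightarrow> strict_antimono_on {..<t} b \<Longrightarrow>
     \<forall>i<t. a i \<le> K \<and> b i \<le> K \<Longrightarrow>
     f (frobenius_shape t a b) = det (mat t t (\<lambda>(i, j). f (hook_shape (a i) (b j))))"
  shows "giambelli K f"
  using assms unfolding giambelli_def by blast

lemma giambelliD:
  assumes "giambelli K f" "strict_antimono_on {..<t} a" "strict_antimono_on {..<t} b"
    "\<forall>i<t. a i \<le> K \<and> b i \<le> K"
  shows "f (frobenius_shape t a b) = det (mat t t (\<lambda>(i, j). f (hook_shape (a i) (b j))))"
  using assms unfolding giambelli_def by blast

lemma giambelli_cong: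
  assumes "giambelli K f"
    and "\<And>t a b. strict_antimono_on {..<t} a \<Longrightarrow> strict_antimono_on {..<t} b \<Longrightarrow>
      \<forall>i<t. a i \<le> K \<and> b i \<le> K \<Longrightarrow> g (frobenius_shape t a b) = f (frobenius_shape t a b)"
  shows "giambelli K g"
proof (rule giambelliI)
  fix t :: nat and a b :: "nat \<Rightarrow> nat"
  assume ab: "strict_antimono_on {..<t} a" "strict_antimono_on {..<t} b"
    "\<forall>i<t. a i \<le> K \<and> b i \<le> K"
  have "g (hook_shape (a i) (b j)) = f (hook_shape (a i) (b j))" if "i < t" "j < t" for i j
    using that ab(3) by (intro assms(2)) (auto simp: monotone_on_def)
  then have "mat t t (\<lambda>(i, j). g (hook_shape (a i) (b j))) =
      mat t t (\<lambda>(i, j). f (hook_shape (a i) (b j)))"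
    by (intro cong_mat) auto
  with assms(2)[OF ab] giambelliD[OF assms(1) ab]
  show "g (frobenius_shape t a b) = det (mat t t (\<lambda>(i, j). g (hook_shape (a i) (b j))))"
    by simp
qed

lemma giambelli_indicator_empty: "giambelli K (\<lambda>D. if D = {} then 1 else 0)"
proof (rule giambelliI)
  fix t and a b :: "nat \<Rightarrow> nat"
  have ne: "frobenius_shape t a b \<noteq> {}" if "0 < t" for t and a b :: "nat \<Rightarrow> nat"
  proof -
    have "(1, 1) \<in> frobenius_shape t a b" using that by (auto simp: mem_frobenius_shape)
    then show ?thesis by blast
  qed
  show "(if frobenius_shape t a b = {} then 1 else 0 :: 'a) =
      det (mat t t (\<lambda>(i, j). if hook_shape (a i) (b j) = {} then 1 else 0))"
  proof (cases t)
    case (Suc s)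
    have "det (mat t t (\<lambda>(i, j). if hook_shape (a i) (b j) = {} then 1 else 0 :: 'a)) = 0"
      unfolding Suc by (subst laplace_expansion_row[of _ "Suc s" 0]) (simp_all add: ne)
    then show ?thesis using ne[of t a b] Suc by simp
  qed simp
qed

text \<open>
  Transposing a shape exchanges arms and legs, which transposes the matrix.
\<close>

lemma giambelli_swap:
  assumes "giambelli K f"
  shows "giambelli K (\<lambda>D. f (prod.swap ` D))"
proof (rule giambelliI)
  fix t :: nat and a b :: "nat \<Rightarrow> nat"
  assume ab: "strict_antimono_on {..<t} a" "strict_antimono_on {..<t} b"
    "\<forall>i<t. a i \<le> K \<and> b i \<le> K"
  have "f (frobenius_shape t b a) = det (mat t t (\<lambda>(i, j). f (hook_shape (b i) (a j))))"
    using ab by (intro giambelliD[OF assms]) auto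
  also have "\<dots> = det (transpose_mat (mat t t (\<lambda>(i, j). f (hook_shape (b i) (a j)))))"
    by (rule det_transpose[of _ t, symmetric]) simp
  also have "transpose_mat (mat t t (\<lambda>(i, j). f (hook_shape (b i) (a j)))) =
      mat t t (\<lambda>(i, j). f (hook_shape (b j) (a i)))"
    by (rule eq_matI) auto
  finally show "f (prod.swap ` frobenius_shape t a b) =
      det (mat t t (\<lambda>(i, j). f (prod.swap ` hook_shape (a i) (b j))))"
    by (simp add: frobenius_shape_swap)
qed

lemma corners_swap: "corners k (prod.swap ` D) = prod.swap ` corners (- k) D"
proof -
  have "(r, c) \<in> corners k (prod.swap ` D) \<longleftrightarrow> (r, c) \<in> prod.swap ` corners (- k) D" for r c
    unfolding corners_def pair_in_swap_image box_content_def by (simp add: pair_in_swap_image) auto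
  then show ?thesis by (simp only: set_eq_iff split_paired_All) simp
qed

lemma corner_step_swap:
  "corner_step y k f (prod.swap ` D) = corner_step y (- k) (\<lambda>D. f (prod.swap ` D)) D"
proof -
  have "(\<Sum>z\<in>prod.swap ` corners (- k) D. y * f (prod.swap ` D - {z})) =
      (\<Sum>z\<in>corners (- k) D. y * f (prod.swap ` D - {prod.swap z}))"
    by (subst sum.reindex) (simp_all add: o_def)
  also have "\<dots> = (\<Sum>z\<in>corners (- k) D. y * f (prod.swap ` (D - {z})))"
    by (simp add: image_set_diff)
  finally show ?thesis by (simp add: corner_step_def corners_swap)
qed

lemma corner_step_hook_shape_pos:
  assumes "0 < k"
  shows "corner_step y (int k) f (hook_shape u v) =
    f (hook_shape u v) + (if u = k then y * f (hook_shape (k - 1) v) else 0)"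
proof (cases "u = k")
  case True
  have "corners (int k) (hook_shape u v) = {(Suc 0, Suc k)}"
    using assms True by (subst corners_frobenius_shape_pos) (auto simp: monotone_on_def)
  moreover have "hook_shape u v - {(Suc 0, Suc k)} = hook_shape (k - 1) v"
    using frobenius_shape_remove_pos[of 0 "Suc 0" "\<lambda>_. u" k "\<lambda>_. v"] assms True
      frobenius_shape_cong[of "Suc 0" "(\<lambda>_. k)(0 := k - 1)" "\<lambda>_. k - 1" "\<lambda>_. v" "\<lambda>_. v"] by simp
  ultimately show ?thesis using True by (simp add: corner_step_def)
next
  case False
  then have "corners (int k) (hook_shape u v) = {}"
    using assms by (subst corners_frobenius_shape_pos) (auto simp: monotone_on_def)
  then show ?thesis using False by (simp add: corner_step_def)
qed

lemma corner_step_hook_shape_zero: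
  "corner_step y 0 f (hook_shape u v) =
    f (hook_shape u v) + (if u = 0 \<and> v = 0 then y * f {} else 0)"
proof -
  have "corners 0 (hook_shape u v) = (if u = 0 \<and> v = 0 then {(Suc 0, Suc 0)} else {})"
    using corners_zero_Suc[of 0 "\<lambda>_. u" "\<lambda>_. v"] by (simp add: monotone_on_def)
  moreover have "f (hook_shape 0 0 - {(Suc 0, Suc 0)}) = f {}"
    using frobenius_shape_remove_zero[of "\<lambda>_. 0" 0 "\<lambda>_. 0"]
    by (simp only: frobenius_shape_0)
  ultimately show ?thesis by (simp add: corner_step_def)
qed

text \<open>
  For positive content the step replaces the row of the unique arm of length \<open>k\<close>, if there is one, by
  this row plus \<open>y\<close> times the row for an arm of length \<open>k - 1\<close>.  By linearity the determinant grows
  by \<open>y\<close> times that of the matrix \<open>?N\<close> in which the row itself is exchanged.  That matrix belongs to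
  the shape without the corner, or it has two equal rows if the next arm has length \<open>k - 1\<close>, which
  is exactly the case in which no corner exists.
\<close>

lemma giambelli_corner_step_pos:
  assumes f: "giambelli K f" and k: "0 < k"
  shows "giambelli K (corner_step y (int k) f)"
proof (rule giambelliI)
  fix t :: nat and a b :: "nat \<Rightarrow> nat"
  assume a: "strict_antimono_on {..<t} a" and b: "strict_antimono_on {..<t} b"
    and K: "\<forall>i<t. a i \<le> K \<and> b i \<le> K"
  let ?D = "frobenius_shape t a b"
  let ?H = "\<lambda>u j. f (hook_shape u (b j))"
  let ?M = "mat t t (\<lambda>(i, j). corner_step y (int k) f (hook_shape (a i) (b j)))"
  have less: "a j < a i" if "i < j" "j < t" for i j
    using a that by (auto simp: monotone_on_def)
  have fD: "f ?D = det (mat t t (\<lambda>(i, j). ?H (a i) j))"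
    by (rule giambelliD[OF f a b K])
  have corners: "corners (int k) ?D =
      {(Suc i, Suc (i + k)) | i. i < t \<and> a i = k \<and> (Suc i < t \<longrightarrow> a (Suc i) \<noteq> k - 1)}"
    by (rule corners_frobenius_shape_pos[OF a k])
  show "corner_step y (int k) f ?D = det ?M"
  proof (cases "\<exists>i<t. a i = k")
    case False
    then have "?M = mat t t (\<lambda>(i, j). ?H (a i) j)"
      by (intro cong_mat) (auto simp: corner_step_hook_shape_pos[OF k])
    moreover have "corners (int k) ?D = {}" unfolding corners using False by blast
    ultimately show ?thesis using fD by (simp add: corner_step_def)
  next
    case True
    then obtain s where s: "s < t" "a s = k" by blast
    have unique: "i = s" if "i < t" "a i = k" for i
      using less[of i s] less[of s i] s that by (metis nat_neq_iff)
    let ?N = "mat t t (\<lambda>(i, j). if i = s then ?H (k - 1) j else ?H (a i) j)"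
    have "?M = mat t t (\<lambda>(i, j). if i = s then ?H k j + y * ?H (k - 1) j else ?H (a i) j)"
      using s by (intro cong_mat) (auto simp: corner_step_hook_shape_pos[OF k] dest: unique)
    then have "det ?M = det (mat t t (\<lambda>(i, j). if i = s then ?H k j else ?H (a i) j)) + y * det ?N"
      using det_row_linear[OF s(1)] by simp
    also have "mat t t (\<lambda>(i, j). if i = s then ?H k j else ?H (a i) j) =
        mat t t (\<lambda>(i, j). ?H (a i) j)"
      using s by (intro cong_mat) auto
    finally have M: "det ?M = f ?D + y * det ?N" using fD by simp
    show ?thesis
    proof (cases "Suc s < t \<and> a (Suc s) = k - 1")
      case True
      then have "row ?N s = row ?N (Suc s)"
        using s by (intro eq_vecI) auto
      then have "det ?N = 0"
        using True s by (intro det_identical_rows[of _ t s "Suc s"]) auto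
      moreover have "corners (int k) ?D = {}"
        unfolding corners using True unique by blast
      ultimately show ?thesis using M by (simp add: corner_step_def)
    next
      case False
      let ?a = "a(s := k - 1)"
      have "corners (int k) ?D = {(Suc s, Suc (s + k))}"
        unfolding corners using False unique s by blast
      moreover have "f (?D - {(Suc s, Suc (s + k))}) = det ?N"
      proof -
        have "strict_antimono_on {..<t} ?a"
        proof (rule monotone_onI)
          fix i j
          assume ij: "i \<in> {..<t}" "j \<in> {..<t}" "i < j"
          have "a j < k - 1" if "i = s"
          proof -
            have "Suc s < t" using ij that by simp
            with False less[of s "Suc s"] s have "a (Suc s) < k - 1" by auto
            moreover have "a j \<le> a (Suc s)"
              using less[of "Suc s" j] ij that by (cases "j = Suc s") auto
            ultimately show ?thesis by simp
          qed
          then show "?a j < ?a i"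
            using less[of i j] ij s by auto
        qed
        moreover have "\<forall>i<t. ?a i \<le> K \<and> b i \<le> K" using K s by fastforce
        ultimately have "f (frobenius_shape t ?a b) =
            det (mat t t (\<lambda>(i, j). f (hook_shape (?a i) (b j))))"
          by (intro giambelliD[OF f _ b])
        also have "mat t t (\<lambda>(i, j). f (hook_shape (?a i) (b j))) = ?N"
          by (rule cong_mat) auto
        finally show ?thesis using frobenius_shape_remove_pos[of s t a k b, OF s k] by (simp add: fun_upd_def)
      qed
      ultimately show ?thesis using M by (simp add: corner_step_def)
    qed
  qed
qed

text \<open>
  For content 0 the step changes a hook only if it is a single box, and an entry of the matrix
  can come from such a hook only in the last diagonal position.
\<close>

lemma giambelli_corner_step_zero:
  assumes f: "giambelli K f"
  shows "giambelli K (corner_step y 0 f)"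
proof (rule giambelliI)
  fix t :: nat and a b :: "nat \<Rightarrow> nat"
  assume a: "strict_antimono_on {..<t} a" and b: "strict_antimono_on {..<t} b"
    and K: "\<forall>i<t. a i \<le> K \<and> b i \<le> K"
  let ?D = "frobenius_shape t a b"
  let ?H = "\<lambda>i j. f (hook_shape (a i) (b j))"
  \<comment> \<open>This is the determinantal identity for the empty shape, whose matrix has size 0.\<close>
  have empty: "f {} = 1"
    using giambelliD[OF f, of 0 a b] by (simp add: monotone_on_def)
  have fD: "f ?D = det (mat t t (\<lambda>(i, j). ?H i j))"
    by (rule giambelliD[OF f a b K])
  show "corner_step y 0 f ?D =
      det (mat t t (\<lambda>(i, j). corner_step y 0 f (hook_shape (a i) (b j))))"
  proof (cases t)
    case 0
    then show ?thesis using empty by (simp add: corner_step_def corners_def)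
  next
    case (Suc s)
    have last: "i = s" if "i < t" "a i = 0 \<or> b i = 0" for i
    proof (rule ccontr)
      assume "i \<noteq> s"
      then have "a s < a i" "b s < b i" using a b that Suc by (auto simp: monotone_on_def)
      with that show False by auto
    qed
    let ?y = "if a s = 0 \<and> b s = 0 then y else 0"
    have "mat t t (\<lambda>(i, j). corner_step y 0 f (hook_shape (a i) (b j))) =
        mat t t (\<lambda>(i, j). ?H i j + (if i = s \<and> j = s then ?y else 0))"
      by (intro cong_mat) (auto simp: corner_step_hook_shape_zero empty dest: last)
    then have M: "det (mat t t (\<lambda>(i, j). corner_step y 0 f (hook_shape (a i) (b j)))) =
        f ?D + ?y * det (mat s s (\<lambda>(i, j). ?H i j))"
      using det_add_last_diagonal[of s ?H ?y] fD Suc by simp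
    have minor: "f (frobenius_shape s a b) = det (mat s s (\<lambda>(i, j). ?H i j))"
      using a b K Suc by (intro giambelliD[OF f]) (auto simp: monotone_on_def)
    have "corners 0 ?D = (if a s = 0 \<and> b s = 0 then {(Suc s, Suc s)} else {})"
      using corners_zero_Suc a b Suc by simp
    then show ?thesis
      using M minor frobenius_shape_remove_zero[of a s b] Suc
      by (simp add: corner_step_def)
  qed
qed

theorem giambelli_corner_step:
  assumes f: "giambelli K f"
  shows "giambelli K (corner_step y k f)"
proof (cases k "0 :: int" rule: linorder_cases)
  case less
  then obtain m where m: "- k = int m" "0 < m"
    by (metis neg_0_less_iff_less pos_int_cases)
  have "giambelli K (\<lambda>D. corner_step y (int m) (\<lambda>D. f (prod.swap ` D)) (prod.swap ` D))"
    by (intro giambelli_swap giambelli_corner_step_pos f m)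
  then show ?thesis
    by (rule giambelli_cong) (simp add: corner_step_swap image_image flip: m(1))
next
  case equal
  then show ?thesis using giambelli_corner_step_zero[OF f] by simp
next
  case greater
  then show ?thesis using giambelli_corner_step_pos[OF f] by (metis pos_int_cases)
qed

section \<open>Tableaux with bounded entries\<close>

text \<open>
  Semistandard tableaux of shape \<open>D\<close> whose pairs (entry, content) are at most \<open>(n, k)\<close>
  lexicographically.
\<close>

definition tableaux_upto :: "nat \<Rightarrow> int \<Rightarrow> (nat \<times> nat) set \<Rightarrow> (nat \<times> nat \<Rightarrow> nat) set" where
  "tableaux_upto n k D = {T \<in> D \<rightarrow>\<^sub>E {1..}.
     (\<forall>i j l. (i, j) \<in> D \<and> (i, l) \<in> D \<and> j < l \<longrightarrow> T (i, j) \<le> T (i, l)) \<and>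
     (\<forall>i l j. (i, j) \<in> D \<and> (l, j) \<in> D \<and> i < l \<longrightarrow> T (i, j) < T (l, j)) \<and>
     (\<forall>z\<in>D. T z < n \<or> T z = n \<and> box_content z \<le> k)}"

definition tableau_sum ::
    "(int \<Rightarrow> nat \<Rightarrow> 'a :: comm_ring_1) \<Rightarrow> nat \<Rightarrow> int \<Rightarrow> (nat \<times> nat) set \<Rightarrow> 'a" where
  "tableau_sum x n k D = (\<Sum>T\<in>tableaux_upto n k D. \<Prod>z\<in>D. x (box_content z) (T z))"

lemma tableaux_uptoD:
  assumes "T \<in> tableaux_upto n k D"
  shows "T \<in> D \<rightarrow>\<^sub>E {1..}"
    and "\<And>i j l. (i, j) \<in> D \<Longrightarrow> (i, l) \<in> D \<Longrightarrow> j < l \<Longrightarrow> T (i, j) \<le> T (i, l)"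
    and "\<And>i l j. (i, j) \<in> D \<Longrightarrow> (l, j) \<in> D \<Longrightarrow> i < l \<Longrightarrow> T (i, j) < T (l, j)"
    and "\<And>z. z \<in> D \<Longrightarrow> T z < n \<or> T z = n \<and> box_content z \<le> k"
  using assms unfolding tableaux_upto_def by blast+

lemma tableaux_uptoI:
  assumes "T \<in> D \<rightarrow>\<^sub>E {1..}"
    and "\<And>i j l. (i, j) \<in> D \<Longrightarrow> (i, l) \<in> D \<Longrightarrow> j < l \<Longrightarrow> T (i, j) \<le> T (i, l)"
    and "\<And>i l j. (i, j) \<in> D \<Longrightarrow> (l, j) \<in> D \<Longrightarrow> i < l \<Longrightarrow> T (i, j) < T (l, j)"
    and "\<And>z. z \<in> D \<Longrightarrow> T z < n \<or> T z = n \<and> box_content z \<le> k"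
  shows "T \<in> tableaux_upto n k D"
  using assms unfolding tableaux_upto_def by blast

lemma finite_tableaux_upto:
  assumes "finite D"
  shows "finite (tableaux_upto n k D)"
proof (rule finite_subset)
  show "tableaux_upto n k D \<subseteq> D \<rightarrow>\<^sub>E {..n}"
  proof
    fix T
    assume T: "T \<in> tableaux_upto n k D"
    have "T z \<le> n" if "z \<in> D" for z using tableaux_uptoD(4)[OF T that] by auto
    with tableaux_uptoD(1)[OF T] show "T \<in> D \<rightarrow>\<^sub>E {..n}" by (auto simp: PiE_iff)
  qed
  show "finite (D \<rightarrow>\<^sub>E {..n})" using assms by (simp add: finite_PiE)
qed

text \<open>
  A box to the right has an entry that is at least \<open>n\<close> and a larger content, and a box below has a
  larger entry; the bound on the pairs excludes both.
\<close>

lemma largest_letter_at_corner: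
  assumes T: "T \<in> tableaux_upto n k D" and z: "z \<in> D" "T z = n" "box_content z = k"
  shows "z \<in> corners k D"
proof -
  obtain i j where ij: "z = (i, j)" by (cases z)
  have "(i, l) \<notin> D" if "j < l" for l
  proof
    assume l: "(i, l) \<in> D"
    with tableaux_uptoD(2)[OF T, of i j l] tableaux_uptoD(4)[OF T l] z that
    show False by (auto simp: ij box_content_def)
  qed
  moreover have "(l, j) \<notin> D" if "i < l" for l
  proof
    assume l: "(l, j) \<in> D"
    with tableaux_uptoD(3)[OF T, of i j l] tableaux_uptoD(4)[OF T l] z that
    show False by (auto simp: ij)
  qed
  ultimately show ?thesis using z by (simp add: ij corners_def)
qed

lemma tableaux_upto_remove_letter:
  "tableaux_upto n (k - 1) D = {T \<in> tableaux_upto n k D. \<forall>z\<in>corners k D. T z \<noteq> n}"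
proof (intro subset_antisym subsetI)
  fix T
  assume T: "T \<in> tableaux_upto n (k - 1) D"
  have "T \<in> tableaux_upto n k D"
    using tableaux_uptoD(4)[OF T] by (intro tableaux_uptoI tableaux_uptoD[OF T]) fastforce+
  moreover have "T z \<noteq> n" if "z \<in> corners k D" for z
    using tableaux_uptoD(4)[OF T, of z] that by (auto simp: corners_def)
  ultimately show "T \<in> {T \<in> tableaux_upto n k D. \<forall>z\<in>corners k D. T z \<noteq> n}" by blast
next
  fix T
  assume "T \<in> {T \<in> tableaux_upto n k D. \<forall>z\<in>corners k D. T z \<noteq> n}"
  then have T: "T \<in> tableaux_upto n k D" and "\<And>z. z \<in> corners k D \<Longrightarrow> T z \<noteq> n" by auto
  then have ne: "T z \<noteq> n" if "z \<in> D" "box_content z = k" for z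
    using largest_letter_at_corner[OF T] that by blast
  have "T z < n \<or> T z = n \<and> box_content z \<le> k - 1" if "z \<in> D" for z
    using tableaux_uptoD(4)[OF T that] ne[OF that] by (metis zle_diff1_eq order_le_less)
  then show "T \<in> tableaux_upto n (k - 1) D"
    by (intro tableaux_uptoI tableaux_uptoD[OF T])
qed

text \<open>
  Boxes above the corner have larger content, so the bound \<open>(n, k - 1)\<close> forces their entries to be
  strictly below \<open>n\<close>; for the boxes to the left the bound \<open>n\<close> is enough.
\<close>

lemma tableaux_upto_fill_corner:
  assumes z: "z \<in> corners k D" and n: "0 < n" and T: "T \<in> tableaux_upto n (k - 1) (D - {z})"
  shows "T(z := n) \<in> tableaux_upto n k D"
proof -
  obtain i j where ij: "z = (i, j)" by (cases z)
  from z have D: "z \<in> D" and k: "k = int j - int i"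
    and no_right: "\<And>l. j < l \<Longrightarrow> (i, l) \<notin> D" and no_below: "\<And>l. i < l \<Longrightarrow> (l, j) \<notin> D"
    by (auto simp: corners_def ij box_content_def)
  note T = tableaux_uptoD[OF T]
  show ?thesis
  proof (rule tableaux_uptoI)
    have "T(z := n) \<in> extensional D"
      using T(1) D by (auto simp: PiE_iff extensional_def)
    then show "T(z := n) \<in> D \<rightarrow>\<^sub>E {1..}"
      using T(1) D n by (auto simp: PiE_iff)
  next
    fix r c l
    assume rc: "(r, c) \<in> D" "(r, l) \<in> D" "c < l"
    with no_right have "(r, c) \<noteq> z" by (auto simp: ij)
    moreover have "T (r, c) \<le> n" using T(4)[of "(r, c)"] rc \<open>(r, c) \<noteq> z\<close> by auto
    ultimately show "(T(z := n)) (r, c) \<le> (T(z := n)) (r, l)"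
      using T(2)[of r c l] rc by auto
  next
    fix r l c
    assume rc: "(r, c) \<in> D" "(l, c) \<in> D" "r < l"
    with no_below have ne: "(r, c) \<noteq> z" by (auto simp: ij)
    show "(T(z := n)) (r, c) < (T(z := n)) (l, c)"
    proof (cases "(l, c) = z")
      case True
      with rc have "\<not> box_content (r, c) \<le> k - 1" by (simp add: ij k box_content_def)
      with T(4)[of "(r, c)"] rc ne have "T (r, c) < n" by auto
      then show ?thesis using True ne by simp
    next
      case False
      then show ?thesis using T(3)[of r c l] rc ne by simp
    qed
  next
    fix w
    assume "w \<in> D"
    then show "(T(z := n)) w < n \<or> (T(z := n)) w = n \<and> box_content w \<le> k"
      using T(4)[of w] by (auto simp: ij k box_content_def)
  qed
qed

lemma tableaux_upto_clear_corner:
  assumes unique: "\<And>w. w \<in> corners k D \<Longrightarrow> w = z" and T: "T \<in> tableaux_upto n k D"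
  shows "T(z := undefined) \<in> tableaux_upto n (k - 1) (D - {z})"
proof -
  note T' = tableaux_uptoD[OF T]
  show ?thesis
  proof (rule tableaux_uptoI)
    show "T(z := undefined) \<in> D - {z} \<rightarrow>\<^sub>E {1..}"
      using T'(1) by (auto simp: PiE_iff extensional_def)
  next
    fix w
    assume w: "w \<in> D - {z}"
    then have "\<not> (T w = n \<and> box_content w = k)"
      using largest_letter_at_corner[OF T, of w] unique by blast
    with T'(4)[of w] w
    show "(T(z := undefined)) w < n \<or> (T(z := undefined)) w = n \<and> box_content w \<le> k - 1"
      by auto
  qed (use T'(2,3) in auto)
qed

text \<open>
  The tableaux that do not have \<open>n\<close> in the corner of content \<open>k\<close> are those bounded by
  \<open>(n, k - 1)\<close>.  Emptying the corner is a bijection from the remaining ones to the tableaux of the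
  smaller shape with the same bound.
\<close>

lemma tableau_sum_corner_step:
  assumes fin: "finite D" and n: "0 < n"
    and unique: "\<And>z w. z \<in> corners k D \<Longrightarrow> w \<in> corners k D \<Longrightarrow> w = z"
  shows "tableau_sum x n k D = corner_step (x k n) k (tableau_sum x n (k - 1)) D"
proof (cases "corners k D = {}")
  case True
  then have "tableaux_upto n (k - 1) D = tableaux_upto n k D"
    by (simp add: tableaux_upto_remove_letter)
  then show ?thesis using True by (simp add: tableau_sum_def corner_step_def)
next
  case False
  then obtain z where z: "z \<in> corners k D" by blast
  with unique have corners: "corners k D = {z}" by blast
  from z have D: "z \<in> D" "box_content z = k" by (auto simp: corners_def)
  let ?w = "\<lambda>D T. \<Prod>z\<in>D. x (box_content z) (T z)"
  let ?A = "tableaux_upto n k D" and ?B = "tableaux_upto n (k - 1) (D - {z})"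
  have "tableau_sum x n k D = (\<Sum>T\<in>{T \<in> ?A. T z \<noteq> n}. ?w D T) + (\<Sum>T\<in>{T \<in> ?A. T z = n}. ?w D T)"
    unfolding tableau_sum_def
    by (subst sum.union_disjoint[symmetric])
       (auto simp: finite_tableaux_upto[OF fin] intro!: sum.cong)
  also have "{T \<in> ?A. T z \<noteq> n} = tableaux_upto n (k - 1) D"
    by (simp add: tableaux_upto_remove_letter corners)
  also have "(\<Sum>T\<in>{T \<in> ?A. T z = n}. ?w D T) = (\<Sum>T\<in>?B. x k n * ?w (D - {z}) T)"
  proof (rule sum.reindex_bij_witness[where i = "\<lambda>T. T(z := n)" and j = "\<lambda>T. T(z := undefined)"])
    fix T
    assume T: "T \<in> {T \<in> ?A. T z = n}"
    then show "(T(z := undefined))(z := n) = T" by auto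
    show "T(z := undefined) \<in> ?B"
      using tableaux_upto_clear_corner[of k D z T n] T corners by blast
    have "?w D T = x (box_content z) (T z) * ?w (D - {z}) T"
      by (rule prod.remove[OF fin D(1)])
    also have "?w (D - {z}) T = ?w (D - {z}) (T(z := undefined))"
      by (rule prod.cong) auto
    finally show "x k n * ?w (D - {z}) (T(z := undefined)) = ?w D T"
      using T D by simp
  next
    fix T
    assume T: "T \<in> ?B"
    have "T z = undefined"
      using PiE_arb[OF tableaux_uptoD(1)[OF T], of z] by simp
    then show "(T(z := n))(z := undefined) = T" by auto
    show "T(z := n) \<in> {T \<in> ?A. T z = n}"
      using tableaux_upto_fill_corner[OF z n T] by simp
  qed
  finally show ?thesis
    by (simp add: tableau_sum_def corner_step_def corners sum_distrib_left)
qed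

lemma tableau_sum_0: "tableau_sum x 0 k D = (if D = {} then 1 else 0)"
proof (cases "D = {}")
  case True
  then have "tableaux_upto 0 k D = {\<lambda>_. undefined}" by (auto simp: tableaux_upto_def)
  then show ?thesis using True by (simp add: tableau_sum_def)
next
  case False
  then obtain z where z: "z \<in> D" by blast
  have "T \<notin> tableaux_upto 0 k D" for T
  proof
    assume T: "T \<in> tableaux_upto 0 k D"
    have "1 \<le> T z" using tableaux_uptoD(1)[OF T] z by (auto simp: PiE_iff)
    with tableaux_uptoD(4)[OF T z] show False by simp
  qed
  then have "tableaux_upto 0 k D = {}" by blast
  with False show ?thesis by (simp add: tableau_sum_def)
qed

lemma corners_frobenius_shape_unique:
  assumes a: "strict_antimono_on {..<t} a" and b: "strict_antimono_on {..<t} b"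
    and "z \<in> corners k (frobenius_shape t a b)" "w \<in> corners k (frobenius_shape t a b)"
  shows "w = z"
proof -
  have inj: "i = j" if "strict_antimono_on {..<t} d" "i < t" "j < t" "d i = d j"
    for i j and d :: "nat \<Rightarrow> nat"
    using that by (metis lessThan_iff monotone_onD nat_neq_iff)
  have pos: "w = z" if a: "strict_antimono_on {..<t} a" and m: "0 < m"
    and zw: "z \<in> corners (int m) (frobenius_shape t a b)"
      "w \<in> corners (int m) (frobenius_shape t a b)"
    for z w a b m
  proof -
    from zw obtain i j where "z = (Suc i, Suc (i + m))" "w = (Suc j, Suc (j + m))"
      "i < t" "j < t" "a i = m" "a j = m"
      unfolding corners_frobenius_shape_pos[OF a m] by auto
    with inj[OF a] show ?thesis by metis
  qed
  show ?thesis
  proof (cases k "0 :: int" rule: linorder_cases)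
    case less
    then obtain m where m: "- k = int m" "0 < m"
      by (metis neg_0_less_iff_less pos_int_cases)
    have "corners (int m) (frobenius_shape t b a) = prod.swap ` corners k (frobenius_shape t a b)"
      by (simp flip: frobenius_shape_swap[of t a b] m(1) add: corners_swap)
    then have "prod.swap w = prod.swap z"
      using assms(3,4) by (intro pos[OF b m(2)]) auto
    then show ?thesis by (simp add: prod_eq_iff)
  next
    case equal
    with assms show ?thesis
      by (cases t) (auto simp: corners_zero_Suc corners_def[of _ "{}"] split: if_splits)
  next
    case greater
    then show ?thesis using pos[OF a] assms(3,4) by (metis pos_int_cases)
  qed
qed

lemma content_frobenius_shape:
  assumes "z \<in> frobenius_shape t a b" "\<forall>i<t. a i \<le> K \<and> b i \<le> K"
  shows "- int K \<le> box_content z" "box_content z \<le> int K"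
  using assms unfolding frobenius_shape_def box_content_def by fastforce+

text \<open>
  The pairs (entry, content) are admitted one after the other.  When all contents up to \<open>K\<close> have been
  processed for the entry \<open>n\<close>, the bound \<open>(n, K)\<close> coincides with \<open>(n + 1, - K - 1)\<close>, and the next
  entry begins.
\<close>

theorem giambelli_tableau_sum:
  assumes "- int K - 1 \<le> k"
  shows "giambelli K (tableau_sum x n k)"
  using assms
proof (induction n arbitrary: k)
  case 0
  show ?case using giambelli_indicator_empty by (simp add: tableau_sum_0)
next
  case (Suc n)
  from Suc.prems show ?case
  proof (induction k rule: int_ge_induct)
    case base
    have "tableaux_upto (Suc n) (- int K - 1) D = tableaux_upto n (int K) D"
      if "D = frobenius_shape t a b" "\<forall>i<t. a i \<le> K \<and> b i \<le> K" for D t a b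
    proof -
      have "T z < Suc n \<or> T z = Suc n \<and> box_content z \<le> - int K - 1 \<longleftrightarrow>
          T z < n \<or> T z = n \<and> box_content z \<le> int K" if "z \<in> D" for z and T :: "nat \<times> nat \<Rightarrow> nat"
        using content_frobenius_shape[of z t a b K] that \<open>D = _\<close> \<open>\<forall>i<t. _\<close> by auto
      then show ?thesis unfolding tableaux_upto_def by (simp cong: conj_cong)
    qed
    then show ?case
      by (intro giambelli_cong[OF Suc.IH[of "int K"]]) (simp_all add: tableau_sum_def)
  next
    case (step k)
    have "giambelli K (corner_step (x (k + 1) (Suc n)) (k + 1) (tableau_sum x (Suc n) k))"
      by (intro giambelli_corner_step step.IH)
    then show ?case
    proof (rule giambelli_cong)
      fix t :: nat and a b :: "nat \<Rightarrow> nat"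
      assume "strict_antimono_on {..<t} a" "strict_antimono_on {..<t} b"
      then show "tableau_sum x (Suc n) (k + 1) (frobenius_shape t a b) =
          corner_step (x (k + 1) (Suc n)) (k + 1) (tableau_sum x (Suc n) k) (frobenius_shape t a b)"
        using tableau_sum_corner_step[OF finite_frobenius_shape, of "Suc n" "k + 1" t a b x]
          corners_frobenius_shape_unique[of t a b _ "k + 1"] by simp
    qed
  qed
qed

section \<open>Setting all but finitely many variables to zero\<close>

definition truncate_vars :: "nat \<Rightarrow> mfps \<Rightarrow> mfps" where
  "truncate_vars N f = Abs_mfps (\<lambda>m. if Poly_Mapping.keys m \<subseteq> {..N} then mcoeff f m else 0)"

lemma mcoeff_truncate_vars:
  "mcoeff (truncate_vars N f) m = (if Poly_Mapping.keys m \<subseteq> {..N} then mcoeff f m else 0)"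
  by (simp add: truncate_vars_def Abs_mfps_inverse)

lemma truncate_vars_eqI:
  assumes "\<And>N. truncate_vars N f = truncate_vars N g"
  shows "f = g"
proof (rule mfps_eqI)
  fix m :: "nat \<Rightarrow>\<^sub>0 nat"
  obtain N where "Poly_Mapping.keys m \<subseteq> {..N}"
    using finite_nat_set_iff_bounded_le[of "Poly_Mapping.keys m"] by auto
  then show "mcoeff f m = mcoeff g m"
    using arg_cong[OF assms, of "\<lambda>h. mcoeff h m" N] by (simp add: mcoeff_truncate_vars)
qed

lemma keys_add_nat:
  fixes m n :: "nat \<Rightarrow>\<^sub>0 nat"
  shows "Poly_Mapping.keys (m + n) = Poly_Mapping.keys m \<union> Poly_Mapping.keys n"
  by (auto simp: in_keys_iff lookup_add)

interpretation truncate_vars: comm_ring_hom "truncate_vars N" for N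
proof
  fix f g
  show "truncate_vars N (f + g) = truncate_vars N f + truncate_vars N g"
    by (rule mfps_eqI) (simp add: mcoeff_truncate_vars plus_mfps.rep_eq)
  show "truncate_vars N (f * g) = truncate_vars N f * truncate_vars N g"
  proof (rule mfps_eqI)
    fix m
    have "(\<Sum>(u, v) | u + v = m. mcoeff (truncate_vars N f) u * mcoeff (truncate_vars N g) v) =
        (\<Sum>(u, v) | u + v = m.
          if Poly_Mapping.keys m \<subseteq> {..N} then mcoeff f u * mcoeff g v else 0)"
      by (rule sum.cong) (auto simp: mcoeff_truncate_vars keys_add_nat)
    then show "mcoeff (truncate_vars N (f * g)) m =
        mcoeff (truncate_vars N f * truncate_vars N g) m"
      by (auto simp: mcoeff_truncate_vars times_mfps.rep_eq case_prod_unfold)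
  qed
qed (rule mfps_eqI, simp add: mcoeff_truncate_vars zero_mfps.rep_eq one_mfps.rep_eq)+

lemma mcoeff_sum: "mcoeff (\<Sum>i\<in>I. f i) m = (\<Sum>i\<in>I. mcoeff (f i) m)"
  by (induction I rule: infinite_finite_induct) (simp_all add: plus_mfps.rep_eq zero_mfps.rep_eq)

lemma keys_sum_single:
  fixes g :: "'b \<Rightarrow> nat"
  assumes "finite D" "\<And>z. z \<in> D \<Longrightarrow> g z \<noteq> 0"
  shows "Poly_Mapping.keys (\<Sum>z\<in>D. Poly_Mapping.single (T z) (g z)) = (T ` D :: nat set)"
  using assms
proof (induction D)
  case (insert z D)
  then have "g z \<noteq> 0"
    and "Poly_Mapping.keys (\<Sum>z\<in>D. Poly_Mapping.single (T z) (g z)) = T ` D" by blast+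
  with insert.hyps show ?case by (simp add: keys_add_nat)
qed simp

text \<open>
  The exponents must be positive: otherwise a tableau with an entry above \<open>N\<close> could have a monomial
  free of the variables beyond \<open>t\<^sub>N\<close>, and the truncation would keep it.
\<close>

lemma truncate_schur_qsym:
  assumes pos: "\<And>z. z \<in> diagram lam \<Longrightarrow> 0 < \<gamma> z"
    and c: "\<And>z. z \<in> diagram lam \<Longrightarrow> \<gamma> z = c (box_content z)"
    and k: "\<And>z. z \<in> diagram lam \<Longrightarrow> box_content z \<le> k"
  shows "truncate_vars N (schur_qsym lam \<gamma>) =
    tableau_sum (\<lambda>k n. tvar n ^ c k) N k (diagram lam)"
proof (rule mfps_eqI)
  fix m
  let ?D = "diagram lam"
  let ?M = "\<lambda>T. \<Prod>z\<in>?D. tvar (T z) ^ \<gamma> z"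
  let ?A = "tableaux_upto N k ?D"
  let ?B = "{T \<in> SSYT lam. mcoeff (?M T) m \<noteq> 0}"
  have A: "?A = {T \<in> SSYT lam. T ` ?D \<subseteq> {..N}}"
  proof -
    have "(\<forall>z\<in>?D. T z < N \<or> T z = N \<and> box_content z \<le> k) \<longleftrightarrow> T ` ?D \<subseteq> {..N}"
      for T :: "nat \<times> nat \<Rightarrow> nat"
      using k by (auto simp: le_less)
    then show ?thesis unfolding tableaux_upto_def SSYT_def fillings_def by auto
  qed
  have keys: "Poly_Mapping.keys m = T ` ?D" if "mcoeff (?M T) m \<noteq> 0" for T
  proof -
    have "m = (\<Sum>z\<in>?D. Poly_Mapping.single (T z) (\<gamma> z))"
      using that by (simp add: tvar_power prod_mmonom mcoeff_mmonom split: if_splits)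
    then show ?thesis using keys_sum_single[OF finite_diagram, of lam \<gamma> T] pos by simp
  qed
  have "mcoeff (tableau_sum (\<lambda>k n. tvar n ^ c k) N k ?D) m = (\<Sum>T\<in>?A. mcoeff (?M T) m)"
    unfolding tableau_sum_def mcoeff_sum using c by (intro sum.cong refl) simp
  also have "\<dots> = (if Poly_Mapping.keys m \<subseteq> {..N} then \<Sum>T\<in>?B. mcoeff (?M T) m else 0)"
  proof (cases "Poly_Mapping.keys m \<subseteq> {..N}")
    case True
    have "(\<Sum>T\<in>?A. mcoeff (?M T) m) = (\<Sum>T\<in>?B. mcoeff (?M T) m)"
    proof (rule sum.mono_neutral_right)
      show "finite ?A" by (rule finite_tableaux_upto[OF finite_diagram])
      show "?B \<subseteq> ?A" unfolding A using keys True by auto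
      show "\<forall>T\<in>?A - ?B. mcoeff (?M T) m = 0" unfolding A by blast
    qed
    with True show ?thesis by simp
  next
    case False
    have "mcoeff (?M T) m = 0" if "T \<in> ?A" for T
      using keys[of T] that False unfolding A by auto
    with False show ?thesis by simp
  qed
  also have "\<dots> = mcoeff (truncate_vars N (schur_qsym lam \<gamma>)) m"
    by (simp add: mcoeff_truncate_vars schur_qsym_def formal_sum.rep_eq)
  finally show "mcoeff (truncate_vars N (schur_qsym lam \<gamma>)) m =
      mcoeff (tableau_sum (\<lambda>k n. tvar n ^ c k) N k ?D) m" ..
qed

section \<open>Frobenius coordinates of a partition\<close>

lemma part_antimono:
  assumes "is_partition lam" "1 \<le> i" "i \<le> j"
  shows "part lam j \<le> part lam i"
proof (cases "i < j \<and> j \<le> length lam")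
  case True
  then have "i - 1 < j - 1" "j - 1 < length lam" using assms(2) by auto
  then show ?thesis
    using sorted_wrt_nth_less[of "(\<ge>)" lam "i - 1" "j - 1"] assms True
    by (simp add: part_def is_partition_def)
next
  case False
  then show ?thesis using assms by (cases "i = j") (auto simp: part_def)
qed

lemma diagram_down_closed:
  assumes "is_partition lam" "(i, j) \<in> diagram lam" "1 \<le> k" "k \<le> i" "1 \<le> l" "l \<le> j"
  shows "(k, l) \<in> diagram lam"
  using part_antimono[OF assms(1,3,4)] assms by (auto simp: diagram_def)

lemma down_closed_eq_atLeastAtMost:
  fixes A :: "nat set"
  assumes "finite A" "0 \<notin> A" "\<And>i k. i \<in> A \<Longrightarrow> 1 \<le> k \<Longrightarrow> k \<le> i \<Longrightarrow> k \<in> A"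
  shows "A = {1..card A}"
proof (cases "A = {}")
  case False
  have "A = {1..Max A}"
  proof (intro subset_antisym subsetI)
    fix i
    assume "i \<in> A"
    then show "i \<in> {1..Max A}" using assms(1,2) by (cases i) auto
  next
    fix i
    assume "i \<in> {1..Max A}"
    then show "i \<in> A" using assms(3)[OF Max_in[OF assms(1) False]] by simp
  qed
  then show ?thesis by (metis card_atLeastAtMost diff_Suc_1)
qed simp

text \<open>
  A column of a diagram is down-closed, so it consists of the rows up to its length.
\<close>

lemma mem_diagram_iff_conj_part:
  assumes "is_partition lam" "1 \<le> j"
  shows "(i, j) \<in> diagram lam \<longleftrightarrow> 1 \<le> i \<and> i \<le> conj_part lam j"
proof -
  let ?A = "{i. (i, j) \<in> diagram lam}"
  have "?A = {1..card ?A}"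
  proof (rule down_closed_eq_atLeastAtMost)
    have "?A \<subseteq> fst ` diagram lam" by force
    then show "finite ?A" using finite_diagram by (meson finite_imageI finite_subset)
    show "0 \<notin> ?A" by (simp add: diagram_def)
    show "k \<in> ?A" if "i \<in> ?A" "1 \<le> k" "k \<le> i" for i k
      using diagram_down_closed[OF assms(1), of i j k j] that assms(2) by simp
  qed
  moreover have "card ?A = conj_part lam j"
    unfolding conj_part_def using assms(2) by (simp add: diagram_def)
  ultimately show ?thesis by (metis atLeastAtMost_iff mem_Collect_eq)
qed

lemma mem_diagram_diagonal_iff:
  assumes lam: "is_partition lam" and t: "t = card {i. (i, i) \<in> diagram lam}"
  shows "(i, i) \<in> diagram lam \<longleftrightarrow> 1 \<le> i \<and> i \<le> t"
proof -
  let ?A = "{i. (i, i) \<in> diagram lam}"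
  have "?A = {1..card ?A}"
  proof (rule down_closed_eq_atLeastAtMost)
    have "?A \<subseteq> fst ` diagram lam" by force
    then show "finite ?A" using finite_diagram by (meson finite_imageI finite_subset)
    show "0 \<notin> ?A" by (simp add: diagram_def)
    show "k \<in> ?A" if "i \<in> ?A" "1 \<le> k" "k \<le> i" for i k
      using diagram_down_closed[OF lam, of i i k k] that by simp
  qed
  then have "?A = {1..t}" by (simp only: t)
  then show ?thesis by (metis (no_types, lifting) atLeastAtMost_iff mem_Collect_eq)
qed

text \<open>
  Boxes weakly above the diagonal are governed by the lengths of the rows, those weakly below it by
  the lengths of the columns.  In either case the diagonal box met by the row or the column belongs
  to the diagram, so that row or column is among the first \<open>t\<close>.
\<close>

lemma diagram_frobenius:
  assumes lam: "is_partition lam" and t: "t = card {i. (i, i) \<in> diagram lam}"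
    and arm: "\<And>i. i < t \<Longrightarrow> part lam (Suc i) = Suc i + a i"
    and leg: "\<And>i. i < t \<Longrightarrow> conj_part lam (Suc i) = Suc i + b i"
  shows "diagram lam = frobenius_shape t a b"
    and "strict_antimono_on {..<t} a" and "strict_antimono_on {..<t} b"
proof -
  have "(r, c) \<in> diagram lam \<longleftrightarrow> (r, c) \<in> frobenius_shape t a b" for r c
  proof (cases "1 \<le> r \<and> 1 \<le> c")
    case True
    let ?d = "min r c"
    have diag: "?d \<le> t" if "(r, c) \<in> diagram lam"
      using diagram_down_closed[OF lam that, of ?d ?d] True mem_diagram_diagonal_iff[OF lam t, of ?d]
      by simp
    show ?thesis
    proof (cases "r \<le> c")
      case le: True
      have "(r, c) \<in> diagram lam \<longleftrightarrow> r \<le> t \<and> c \<le> r + a (r - 1)"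
        using diag arm[of "r - 1"] True le by (auto simp: diagram_def)
      moreover have "r \<le> t \<and> c \<le> r + a (r - 1)" if "c = r" "c \<le> t" using that by simp
      ultimately show ?thesis using le True by (auto simp: mem_frobenius_shape)
    next
      case False
      then show ?thesis
        using diag leg[of "c - 1"] True mem_diagram_iff_conj_part[OF lam, of c r]
        by (cases c) (auto simp: mem_frobenius_shape)
    qed
  qed (auto simp: diagram_def mem_frobenius_shape)
  then show "diagram lam = frobenius_shape t a b" by (simp add: set_eq_iff)
  show "strict_antimono_on {..<t} a"
  proof (rule monotone_onI)
    fix i j
    assume "i \<in> {..<t}" "j \<in> {..<t}" "i < j"
    then show "a j < a i" using part_antimono[OF lam, of "Suc i" "Suc j"] arm[of i] arm[of j] by simp
  qed
  show "strict_antimono_on {..<t} b"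
  proof (rule monotone_onI)
    fix i j
    assume ij: "i \<in> {..<t}" "j \<in> {..<t}" "i < j"
    have "(conj_part lam (Suc j), Suc j) \<in> diagram lam"
      using mem_diagram_iff_conj_part[OF lam, of "Suc j"] leg[of j] ij by simp
    then have "(conj_part lam (Suc j), Suc i) \<in> diagram lam"
      by (rule diagram_down_closed[OF lam]) (use leg[of j] ij in auto)
    then have "conj_part lam (Suc j) \<le> conj_part lam (Suc i)"
      using mem_diagram_iff_conj_part[OF lam, of "Suc i"] by simp
    then show "b j < b i" using leg[of i] leg[of j] ij by simp
  qed
qed

lemma diagram_hook: "diagram (hook (Suc u) v) = hook_shape u v"
proof -
  have part: "part (hook (Suc u) v) i = (if i = 1 then Suc u else if 1 < i \<and> i \<le> Suc v then 1 else 0)" for i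
    by (auto simp: part_def hook_def nth_Cons split: nat.splits)
  have "(r, c) \<in> diagram (hook (Suc u) v) \<longleftrightarrow> (r, c) \<in> hook_shape u v" for r c
    unfolding diagram_def by (auto simp: part mem_frobenius_shape)
  then show ?thesis by (simp add: set_eq_iff)
qed

section \<open>The determinant of hooks\<close>

theorem theorem5p4:
  fixes lam :: "nat list" and t :: nat and p q :: "nat \<Rightarrow> nat"
    and \<gamma> :: "nat \<times> nat \<Rightarrow> nat" and c :: "int \<Rightarrow> nat"
  assumes "is_partition lam"
    and "t = card {i. (i, i) \<in> diagram lam}"
    and "\<And>i. 1 \<le> i \<Longrightarrow> i \<le> t \<Longrightarrow> int (p i) = int (part lam i) - int i + 1"
    and "\<And>i. 1 \<le> i \<Longrightarrow> i \<le> t \<Longrightarrow> int (q i) = int (conj_part lam i) - int i"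
    and "\<gamma> \<in> diag_fillings lam"
    and "\<And>i j. (i, j) \<in> diagram lam \<Longrightarrow> c (int j - int i) = \<gamma> (i, j)"
  shows "schur_qsym lam \<gamma> =
    det (mat t t (\<lambda>(i, j).
      schur_qsym (hook (p (i + 1)) (q (j + 1))) (hook_filling c (p (i + 1)) (q (j + 1)))))"
proof (rule truncate_vars_eqI)
  fix N
  define a where "a i = p (Suc i) - 1" for i
  define b where "b j = q (Suc j)" for j
  define K where "K = (\<Sum>i<t. a i + b i)"
  let ?D = "diagram lam"
  let ?S = "tableau_sum (\<lambda>k n. tvar n ^ c k) N (int K)"
  have p: "p (Suc i) = Suc (a i)" and arm: "part lam (Suc i) = Suc i + a i"
    and leg: "conj_part lam (Suc i) = Suc i + b i" if "i < t" for i
  proof -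
    have "(Suc i, Suc i) \<in> ?D" using mem_diagram_diagonal_iff[OF assms(1,2)] that by simp
    then have "Suc i \<le> part lam (Suc i)" by (simp add: diagram_def)
    then show "p (Suc i) = Suc (a i)" "part lam (Suc i) = Suc i + a i"
      using assms(3)[of "Suc i"] that by (simp_all add: a_def)
    show "conj_part lam (Suc i) = Suc i + b i"
      using assms(4)[of "Suc i"] that by (simp add: b_def)
  qed
  have shape: "?D = frobenius_shape t a b"
    and anti: "strict_antimono_on {..<t} a" "strict_antimono_on {..<t} b"
    using diagram_frobenius[OF assms(1,2), of a b] arm leg by blast+
  have K: "\<forall>i<t. a i \<le> K \<and> b i \<le> K"
  proof (intro allI impI)
    fix i
    assume "i < t"
    then have "a i + b i \<le> K" unfolding K_def by (intro member_le_sum) auto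
    then show "a i \<le> K \<and> b i \<le> K" by simp
  qed
  have \<gamma>: "0 < \<gamma> z" "\<gamma> z = c (box_content z)" if "z \<in> ?D" for z
    using assms(5,6) that by (auto simp: diag_fillings_def fillings_def box_content_def PiE_iff)
  have "truncate_vars N (schur_qsym lam \<gamma>) = ?S ?D"
    using \<gamma> content_frobenius_shape(2)[OF _ K] shape by (intro truncate_schur_qsym) auto
  also have "\<dots> = det (mat t t (\<lambda>(i, j). ?S (hook_shape (a i) (b j))))"
    unfolding shape by (rule giambelliD[OF _ anti K]) (simp add: giambelli_tableau_sum)
  also have "mat t t (\<lambda>(i, j). ?S (hook_shape (a i) (b j))) =
      map_mat (truncate_vars N) (mat t t (\<lambda>(i, j).
        schur_qsym (hook (p (i + 1)) (q (j + 1))) (hook_filling c (p (i + 1)) (q (j + 1)))))"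
  proof (rule eq_matI; clarsimp)
    fix i j
    assume ij: "i < t" "j < t"
    let ?h = "hook (Suc (a i)) (b j)"
    let ?g = "hook_filling c (Suc (a i)) (b j)"
    have g: "?g z = c (box_content z)" if "z \<in> diagram ?h" for z
      using that by (cases z)
        (auto simp: hook_filling_def diagram_hook box_content_def mem_frobenius_shape
          intro!: arg_cong[of _ _ c])
    \<comment> \<open>Each content of the hook also occurs in row \<open>Suc i\<close> or column \<open>Suc j\<close> of the diagram.\<close>
    have pos: "0 < c (box_content z)" if "z \<in> diagram ?h" for z
    proof -
      from that consider m where "m \<le> a i" "box_content z = int m" |
        m where "m \<le> b j" "box_content z = - int m"
        unfolding diagram_hook frobenius_shape_def box_content_def by force
      then show ?thesis
      proof cases
        case 1
        then have "(Suc i, Suc (i + m)) \<in> ?D" using ij by (auto simp: shape frobenius_shape_def)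
        with \<gamma>[OF this] 1 show ?thesis by (simp add: box_content_def)
      next
        case 2
        then have "(Suc (j + m), Suc j) \<in> ?D" using ij by (auto simp: shape frobenius_shape_def)
        with \<gamma>[OF this] 2 show ?thesis by (simp add: box_content_def)
      qed
    qed
    have "truncate_vars N (schur_qsym ?h ?g) = ?S (diagram ?h)"
    proof (rule truncate_schur_qsym)
      fix z
      assume z: "z \<in> diagram ?h"
      then show "0 < ?g z" "?g z = c (box_content z)" using pos g by simp_all
      show "box_content z \<le> int K"
        using content_frobenius_shape(2)[of z "Suc 0" "\<lambda>_. a i" "\<lambda>_. b j" K] z K ij
        by (simp add: diagram_hook)
    qed
    then show "?S (hook_shape (a i) (b j)) =
        truncate_vars N (schur_qsym (hook (p (Suc i)) (q (Suc j)))
          (hook_filling c (p (Suc i)) (q (Suc j))))"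
      using p[OF ij(1)] by (simp add: diagram_hook b_def)
  qed
  finally show "truncate_vars N (schur_qsym lam \<gamma>) = truncate_vars N
      (det (mat t t (\<lambda>(i, j).
        schur_qsym (hook (p (i + 1)) (q (j + 1))) (hook_filling c (p (i + 1)) (q (j + 1))))))"
    by simp
qed

end
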